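(* The spaces $H(\mathbb{D}\setminus\{0\})$ and $H(\mathbb{C}\setminus\{0\})$ admit no weakly supercyclic composition operators. That is, for $U=\mathbb{D}\setminus\{0\}$ or $U=\mathbb{C}\setminus\{0\}$ and for every holomorphic map $\varphi:U\to U$, the composition operator $C_\varphi:H(U)\to H(U)$, $f\mapsto f\circ\varphi$, is not weakly supercyclic.
   Context: $\mathbb{D}$ is the open unit disc. $H(U)$ is the space of holomorphic functions on $U$ endowed with the compact-open topology. An operator $T$ on a locally convex space $E$ is weakly supercyclic if there is $f\in E$ such that $\{\lambda T^n f:\lambda\in\mathbb{C},\ n=0,1,2,\dots\}$ is dense in $E$ for the weak topology. *)

theory Defs
  imports "HOL-Complex_Analysis.Complex_Analysis"
begin

text \<open>
  A topological vector space of complex-valued functions (with pointwise operations) is given by a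
  topology \<open>X\<close>, whose carrier \<open>topspace X\<close> is the underlying vector space.
\<close>

definition continuous_dual :: "('a \<Rightarrow> complex) topology \<Rightarrow> (('a \<Rightarrow> complex) \<Rightarrow> complex) set" where
  "continuous_dual X =
     {L. continuous_map X euclidean L \<and>
         (\<forall>f\<in>topspace X. \<forall>g\<in>topspace X. L (\<lambda>x. f x + g x) = L f + L g) \<and>
         (\<forall>c. \<forall>f\<in>topspace X. L (\<lambda>x. c * f x) = c * L f)}"

definition weak_topology :: "('a \<Rightarrow> complex) topology \<Rightarrow> ('a \<Rightarrow> complex) topology" where
  "weak_topology X =
     topology_generated_by
       {{f \<in> topspace X. L f \<in> V} | L V. L \<in> continuous_dual X \<and> open V}"

definition weakly_supercyclic ::
    "('a \<Rightarrow> complex) topology \<Rightarrow> (('a \<Rightarrow> complex) \<Rightarrow> ('a \<Rightarrow> complex)) \<Rightarrow> bool" where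
  "weakly_supercyclic X T \<longleftrightarrow>
     (\<exists>f\<in>topspace X.
        weak_topology X closure_of {(\<lambda>x. c * (T ^^ n) f x) | (c::complex) (n::nat). True} = topspace X)"

text \<open>
  A holomorphic function on \<open>U\<close> is represented by its extension by zero to the whole plane; thus
  equality of representatives is equality on \<open>U\<close>, and pointwise sums and multiples of
  representatives are again representatives.
\<close>

definition holomorphic_functions :: "complex set \<Rightarrow> (complex \<Rightarrow> complex) set" where
  "holomorphic_functions U = {f. f holomorphic_on U \<and> (\<forall>z. z \<notin> U \<longrightarrow> f z = 0)}"

definition compact_open_topology :: "complex set \<Rightarrow> (complex \<Rightarrow> complex) topology" where
  "compact_open_topology U =
     topology_generated_by
       {{f \<in> holomorphic_functions U. f ` K \<subseteq> V} | K V. compact K \<and> K \<subseteq> U \<and> open V}"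

definition composition_operator ::
    "complex set \<Rightarrow> (complex \<Rightarrow> complex) \<Rightarrow> (complex \<Rightarrow> complex) \<Rightarrow> (complex \<Rightarrow> complex)" where
  "composition_operator U \<phi> f = (\<lambda>z. if z \<in> U then f (\<phi> z) else 0)"

lemma topspace_compact_open_topology:
  "topspace (compact_open_topology U) = holomorphic_functions U"
proof -
  have "holomorphic_functions U \<in>
          {{f \<in> holomorphic_functions U. f ` K \<subseteq> V} | K V. compact K \<and> K \<subseteq> U \<and> open V}"
    by (rule CollectI, intro exI[of _ "{}"]) auto
  then show ?thesis
    unfolding compact_open_topology_def topology_generated_by_topspace by blast
qed

lemma topspace_weak_topology: "topspace (weak_topology X) = topspace X"
proof -
  have "(\<lambda>f. 0) \<in> continuous_dual X"
    by (simp add: continuous_dual_def)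
  then have "topspace X \<in> {{f \<in> topspace X. L f \<in> V} | L V. L \<in> continuous_dual X \<and> open V}"
    by (intro CollectI exI[of _ "\<lambda>f. 0"] exI[of _ UNIV]) auto
  then show ?thesis
    unfolding weak_topology_def topology_generated_by_topspace by blast
qed

lemma composition_operator_in_holomorphic_functions:
  assumes "\<phi> holomorphic_on U" "\<phi> ` U \<subseteq> U" "f \<in> holomorphic_functions U"
  shows "composition_operator U \<phi> f \<in> holomorphic_functions U"
proof -
  have "(f \<circ> \<phi>) holomorphic_on U"
    using assms by (auto simp: holomorphic_functions_def intro: holomorphic_on_compose_gen)
  then have "composition_operator U \<phi> f holomorphic_on U"
    by (rule holomorphic_transform) (simp add: composition_operator_def)
  then show ?thesis
    by (simp add: holomorphic_functions_def composition_operator_def)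
qed

end

theory Submission
  imports Defs
begin

text \<open>
  An operator whose transpose has two linearly independent eigenvectors is not weakly supercyclic:
  along an orbit the ratio of the two functionals is \<open>(\<alpha>/\<beta>)\<^sup>n\<close> times a constant, which is not dense.
  If \<open>\<phi>\<close> is not injective, the difference of two evaluations kills the range of \<open>C\<^sub>\<phi>\<close>, which also
  excludes weak supercyclicity. An injective \<open>\<phi>\<close> of the punctured disc extends to \<open>0\<close>. If the value at
  \<open>0\<close> lies in the punctured disc, then \<open>\<integral> f dz\<close> and \<open>\<integral> f z dz\<close> over a small circle vanish on the
  range. If \<open>0\<close> is fixed, with multiplier \<open>\<lambda>\<close>, then \<open>0 < \<bar>\<lambda>\<bar> \<le> 1\<close>, and Koenigs' linearization \<open>\<sigma>\<close>
  (or the Schwarz lemma, if \<open>\<bar>\<lambda>\<bar> = 1\<close>) gives the eigenfunctionals \<open>\<integral> f \<sigma>' dz\<close> and \<open>\<integral> f \<sigma> \<sigma>' dz\<close>.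
  On the punctured plane, \<open>\<phi>\<close> or \<open>1/\<phi>\<close> extends to an entire function; up to the case already
  treated, \<open>\<phi> z\<close> is \<open>a z\<close>, which is linear already, or \<open>1/(a z)\<close>, which has two fixed points.
\<close>

subsection \<open>Functionals and weak supercyclicity\<close>

lemma continuous_map_weak_topology:
  assumes "L \<in> continuous_dual X"
  shows "continuous_map (weak_topology X) euclidean L"
  unfolding continuous_map_def topspace_weak_topology
proof (intro conjI allI impI)
  show "L \<in> topspace X \<rightarrow> topspace euclidean" by simp
next
  fix V :: "complex set" assume "openin euclidean V"
  then show "openin (weak_topology X) {x \<in> topspace X. L x \<in> V}"
    unfolding weak_topology_def using assms
    by (intro topology_generated_by_Basis) auto
qed

text \<open>The preimage of a closed set under the weakly continuous pair \<open>(L, M)\<close> is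
  weakly closed, so it is the whole space once it contains the orbit. The vector \<open>f\<close> is
  fixed before \<open>C\<close>, so that several closed conditions can be tested against one
  orbit.\<close>

lemma weakly_supercyclic_orbit:
  assumes "weakly_supercyclic X T" and LM: "L \<in> continuous_dual X" "M \<in> continuous_dual X"
  shows "\<exists>f\<in>topspace X. \<forall>C. closed C \<longrightarrow>
           (\<forall>c n. (L (\<lambda>x. c * (T ^^ n) f x), M (\<lambda>x. c * (T ^^ n) f x)) \<in> C) \<longrightarrow>
           (\<forall>g\<in>topspace X. (L g, M g) \<in> C)"
proof -
  let ?O = "\<lambda>f. {(\<lambda>x. c * (T ^^ n) f x) | (c::complex) (n::nat). True}"
  have "\<exists>f\<in>topspace X. weak_topology X closure_of ?O f = topspace X"
    using assms(1) unfolding weakly_supercyclic_def .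
  then obtain f where f: "f \<in> topspace X"
    and dense: "weak_topology X closure_of ?O f = topspace X" ..
  show ?thesis
  proof (intro bexI[OF _ f] allI impI ballI)
    fix C g
    assume C: "closed C" and g: "g \<in> topspace X"
      and orbit: "\<forall>c n. (L (\<lambda>x. c * (T ^^ n) f x), M (\<lambda>x. c * (T ^^ n) f x)) \<in> C"
    have "continuous_map (weak_topology X) euclidean (\<lambda>g. (L g, M g))"
      using continuous_map_pairedI[OF LM[THEN continuous_map_weak_topology]] by simp
    then have cl: "closedin (weak_topology X) {g \<in> topspace (weak_topology X). (L g, M g) \<in> C}"
      using C by (intro closedin_continuous_map_preimage) auto
    have "topspace X \<subseteq> weak_topology X closure_of (topspace (weak_topology X) \<inter> ?O f)"
      using dense closure_of_restrict[of "weak_topology X" "?O f"] by simp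
    also have "\<dots> \<subseteq> {g \<in> topspace (weak_topology X). (L g, M g) \<in> C}"
      by (rule closure_of_minimal[OF _ cl]) (use orbit in auto)
    finally show "(L g, M g) \<in> C" using g by blast
  qed
qed

lemma funpow_in_topspace:
  assumes "\<And>f. f \<in> topspace X \<Longrightarrow> T f \<in> topspace X" "f \<in> topspace X"
  shows "(T ^^ n) f \<in> topspace X"
  by (induction n) (use assms in auto)

lemma dual_funpow:
  assumes "L \<in> continuous_dual X"
    and "\<And>f. f \<in> topspace X \<Longrightarrow> T f \<in> topspace X"
    and "\<And>f. f \<in> topspace X \<Longrightarrow> L (T f) = \<alpha> * L f"
    and "f \<in> topspace X"
  shows "L (\<lambda>x. c * (T ^^ n) f x) = c * \<alpha> ^ n * L f"
proof -
  have "L ((T ^^ n) f) = \<alpha> ^ n * L f"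
    by (induction n) (use assms funpow_in_topspace[OF assms(2,4)] in auto)
  then show ?thesis
    using assms(1) funpow_in_topspace[OF assms(2,4)] by (auto simp: continuous_dual_def)
qed

text \<open>
  Along the orbit of \<open>f\<close> the ratio of \<open>\<bar>L\<bar>\<close> to \<open>\<bar>M\<bar>\<close> never exceeds its value at \<open>f\<close>;
  this is a weakly closed condition, and it fails somewhere.
\<close>

lemma not_weakly_supercyclic_two_eigenfunctionals:
  assumes T: "\<And>f. f \<in> topspace X \<Longrightarrow> T f \<in> topspace X"
    and L: "L \<in> continuous_dual X" "\<And>f. f \<in> topspace X \<Longrightarrow> L (T f) = \<alpha> * L f"
    and M: "M \<in> continuous_dual X" "\<And>f. f \<in> topspace X \<Longrightarrow> M (T f) = \<beta> * M f"
    and "norm \<alpha> \<le> norm \<beta>"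
    and g: "g \<in> topspace X" "L g \<noteq> 0" "M g = 0"
    and h: "h \<in> topspace X" "M h \<noteq> 0"
  shows "\<not> weakly_supercyclic X T"
proof
  assume "weakly_supercyclic X T"
  from weakly_supercyclic_orbit[OF this L(1) M(1)] obtain f where f: "f \<in> topspace X"
    and dense0: "\<forall>C. closed C \<longrightarrow>
           (\<forall>c n. (L (\<lambda>x. c * (T ^^ n) f x), M (\<lambda>x. c * (T ^^ n) f x)) \<in> C) \<longrightarrow>
           (\<forall>g\<in>topspace X. (L g, M g) \<in> C)" ..
  have orbit: "L (\<lambda>x. c * (T ^^ n) f x) = c * \<alpha> ^ n * L f" "M (\<lambda>x. c * (T ^^ n) f x) = c * \<beta> ^ n * M f" for c n
    using dual_funpow[of L X T \<alpha> f c n] dual_funpow[of M X T \<beta> f c n] T L M f by simp_all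
  have dense: "(L g, M g) \<in> C"
    if "closed C" "\<And>c n. (c * \<alpha> ^ n * L f, c * \<beta> ^ n * M f) \<in> C" "g \<in> topspace X" for C g
    using dense0[unfolded orbit] that by blast
  have C: "closed {p::complex \<times> complex. norm (fst p) * norm (M f) \<le> norm (L f) * norm (snd p)}"
    by (intro closed_Collect_le continuous_intros)
  have "(L g, M g) \<in> {p::complex \<times> complex. norm (fst p) * norm (M f) \<le> norm (L f) * norm (snd p)}"
  proof (rule dense[OF C _ g(1)])
    fix c :: complex and n
    have "norm c * norm \<alpha> ^ n * (norm (L f) * norm (M f)) \<le> norm c * norm \<beta> ^ n * (norm (L f) * norm (M f))"
      using \<open>norm \<alpha> \<le> norm \<beta>\<close> by (intro mult_right_mono mult_left_mono power_mono) auto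
    then show "(c * \<alpha> ^ n * L f, c * \<beta> ^ n * M f)
        \<in> {p. norm (fst p) * norm (M f) \<le> norm (L f) * norm (snd p)}"
      by (simp add: norm_mult norm_power mult_ac)
  qed
  \<comment> \<open>At \<open>g\<close> the inequality reads
    \<open>norm (L g) * norm (M f) \<le> 0\<close>. In the remaining case \<open>M f = 0\<close> the
    functional \<open>M\<close> vanishes on the whole orbit but not at \<open>h\<close>.\<close>
  then have "M f = 0"
    using g by (auto simp: mult_le_0_iff)
  have "closed {p::complex \<times> complex. snd p = 0}"
    by (intro closed_Collect_eq continuous_intros)
  from dense[OF this _ h(1)] show False
    using h \<open>M f = 0\<close> by simp
qed

text \<open>
  The orbit lies in the union of the line through \<open>f\<close> and the hyperplane \<open>L = 0\<close>.
\<close>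

lemma not_weakly_supercyclic_annihilator:
  assumes T: "\<And>f. f \<in> topspace X \<Longrightarrow> T f \<in> topspace X"
    and L: "L \<in> continuous_dual X" "\<And>f. f \<in> topspace X \<Longrightarrow> L (T f) = 0"
    and M: "M \<in> continuous_dual X"
    and g: "g \<in> topspace X" "L g \<noteq> 0" "M g = 0"
    and h: "h \<in> topspace X" "L h \<noteq> 0" "M h \<noteq> 0"
  shows "\<not> weakly_supercyclic X T"
proof
  assume "weakly_supercyclic X T"
  from weakly_supercyclic_orbit[OF this L(1) M] obtain f where f: "f \<in> topspace X"
    and dense: "\<forall>C. closed C \<longrightarrow>
           (\<forall>c n. (L (\<lambda>x. c * (T ^^ n) f x), M (\<lambda>x. c * (T ^^ n) f x)) \<in> C) \<longrightarrow>
           (\<forall>g\<in>topspace X. (L g, M g) \<in> C)" ..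
  \<comment> \<open>Since \<open>0 ^ 0 = 1\<close>, one formula covers the multiples of
    \<open>f\<close> itself and those of the later iterates, on which \<open>L\<close>
    vanishes.\<close>
  have L0: "L (\<lambda>x. c * (T ^^ n) f x) = c * 0 ^ n * L f" for c n
    using dual_funpow[of L X T 0 f c n] T L f by simp
  have M0: "M (\<lambda>x. c * f x) = c * M f" for c
    using M f by (auto simp: continuous_dual_def)
  \<comment> \<open>The first factor vanishes on the orbit for \<open>n > 0\<close>; the second
    expresses proportionality to \<open>(L f, M f)\<close>, which holds for
    \<open>n = 0\<close>.\<close>
  have C: "closed {p. fst p * (fst p * M f - snd p * L f) = 0}"
    by (intro closed_Collect_eq continuous_intros)
  have "(L (\<lambda>x. c * (T ^^ n) f x), M (\<lambda>x. c * (T ^^ n) f x)) \<in> {p. fst p * (fst p * M f - snd p * L f) = 0}"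
    for c n by (cases n) (use M0 L0[of c 0] in \<open>auto simp: L0 simp del: funpow.simps(2)\<close>)
  with dense C have *: "(L g, M g) \<in> {p. fst p * (fst p * M f - snd p * L f) = 0}"
    if "g \<in> topspace X" for g using that by blast
  \<comment> \<open>At \<open>g\<close> the equation becomes \<open>L g * L g * M f = 0\<close>; at
    \<open>h\<close> it then becomes \<open>L h * M h * L f = 0\<close>.\<close>
  have "M f = 0"
    using *[OF g(1)] g by simp
  then have "L f = 0"
    using *[OF h(1)] h by simp
  have "closed {p::complex \<times> complex. fst p = 0}"
    by (intro closed_Collect_eq continuous_intros)
  moreover have "(L (\<lambda>x. c * (T ^^ n) f x), M (\<lambda>x. c * (T ^^ n) f x)) \<in> {p. fst p = 0}" for c n
    by (simp add: L0 \<open>L f = 0\<close>)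
  ultimately have "(L g, M g) \<in> {p. fst p = 0}"
    using dense g(1) by blast
  then show False
    using g by simp
qed

section \<open>Continuity of functionals in the compact-open topology\<close>

text \<open>A subbasic set confines the image of a compact set to one open \<open>V\<close>, which
  says nothing pointwise. So \<open>K\<close> is cut into finitely many compact pieces on which
  \<open>f\<close> varies by less than \<open>\<delta>/2\<close>, and each piece gets its own small
  ball.\<close>

lemma uniform_neighbourhood_compact_open:
  assumes f: "f \<in> holomorphic_functions U" and K: "compact K" "K \<subseteq> U" and "\<delta> > 0"
  obtains N where "openin (compact_open_topology U) N" "f \<in> N"
    "\<And>g z. \<lbrakk>g \<in> N; z \<in> K\<rbrakk> \<Longrightarrow> norm (g z - f z) \<le> \<delta>"
proof -
  have cont: "continuous_on K f"
    using f K(2) holomorphic_on_imp_continuous_on[of f U] continuous_on_subset[of U f K]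
    by (simp add: holomorphic_functions_def)
  \<comment> \<open>The non-strict bound on the distance permits closed balls below, so that the
    pieces of \<open>K\<close> are compact.\<close>
  have "\<exists>r>0. \<forall>w\<in>K. dist w z \<le> r \<longrightarrow> dist (f w) (f z) < \<delta>/2" if z: "z \<in> K" for z
  proof -
    have "\<delta>/2 > 0" using \<open>\<delta> > 0\<close> by simp
    with cont z obtain d where "d > 0" "\<forall>w\<in>K. dist w z < d \<longrightarrow> dist (f w) (f z) < \<delta>/2"
      unfolding continuous_on_iff by blast
    then show ?thesis
      by (intro exI[of _ "d/2"]) auto
  qed
  then obtain r where r: "\<And>z. z \<in> K \<Longrightarrow> r z > 0"
    "\<And>z w. \<lbrakk>z \<in> K; w \<in> K; dist w z \<le> r z\<rbrakk> \<Longrightarrow> dist (f w) (f z) < \<delta>/2"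
    by metis
  obtain D where D: "D \<subseteq> K" "finite D" "K \<subseteq> (\<Union>z\<in>D. ball z (r z))"
  proof (rule compactE_image[OF K(1), of K "\<lambda>z. ball z (r z)"])
    show "K \<subseteq> (\<Union>z\<in>K. ball z (r z))"
    proof
      show "z \<in> (\<Union>z\<in>K. ball z (r z))" if "z \<in> K" for z
        using that r(1)[OF that] by (intro UN_I[of z]) auto
    qed
  qed auto
  define A where "A z = {g \<in> holomorphic_functions U. g ` (K \<inter> cball z (r z)) \<subseteq> ball (f z) (\<delta>/2)}" for z
  have A: "openin (compact_open_topology U) (A z)" for z
    unfolding compact_open_topology_def A_def
  proof (rule topology_generated_by_Basis, intro CollectI exI conjI)
    show "compact (K \<inter> cball z (r z))" using K by (intro compact_Int_closed) auto
  qed (use K in auto)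
  show ?thesis
  proof (rule that[of "topspace (compact_open_topology U) \<inter> \<Inter> (A ` D)"])
    show "openin (compact_open_topology U) (topspace (compact_open_topology U) \<inter> \<Inter> (A ` D))"
      using D A by (cases "D = {}") (auto intro!: openin_Int openin_INT)
    show "f \<in> topspace (compact_open_topology U) \<inter> \<Inter> (A ` D)"
      using f r D by (auto simp: A_def topspace_compact_open_topology dist_commute)
  next
    fix g z assume g: "g \<in> topspace (compact_open_topology U) \<inter> \<Inter> (A ` D)" and z: "z \<in> K"
    then obtain w where w: "w \<in> D" "dist w z < r w"
      using D by auto
    then have "dist (f w) (g z) < \<delta>/2"
      using g z by (force simp: A_def)
    moreover have "dist (f z) (f w) < \<delta>/2"
      using r w D z by (auto simp: dist_commute)
    ultimately have "dist (g z) (f z) < \<delta>"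
      using dist_triangle_less_add[of "g z" "f w" "\<delta>/2" "f z" "\<delta>/2"] by (simp add: dist_commute)
    then show "norm (g z - f z) \<le> \<delta>"
      by (simp add: dist_norm)
  qed
qed

lemma holomorphic_functions_diff:
  assumes "f \<in> holomorphic_functions U" "g \<in> holomorphic_functions U"
  shows "(\<lambda>z. f z - g z) \<in> holomorphic_functions U"
  using assms by (auto simp: holomorphic_functions_def intro: holomorphic_intros)

lemma holomorphic_functions_cmult:
  assumes "f \<in> holomorphic_functions U"
  shows "(\<lambda>z. c * f z) \<in> holomorphic_functions U"
  using assms by (auto simp: holomorphic_functions_def intro: holomorphic_intros)

text \<open>A linear functional controlled by the size of \<open>f\<close> on one compact set is
  continuous. Quantifying over upper bounds \<open>\<delta>\<close> of \<open>f\<close> on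
  \<open>K\<close> takes the place of a supremum seminorm.\<close>

lemma continuous_dual_compact_openI:
  assumes K: "compact K" "K \<subseteq> U"
    and add: "\<And>f g. \<lbrakk>f \<in> holomorphic_functions U; g \<in> holomorphic_functions U\<rbrakk>
          \<Longrightarrow> L (\<lambda>z. f z + g z) = L f + L g"
    and scale: "\<And>c f. f \<in> holomorphic_functions U \<Longrightarrow> L (\<lambda>z. c * f z) = c * L f"
    and bound: "\<And>f \<delta>. \<lbrakk>f \<in> holomorphic_functions U; \<delta> > 0; \<And>z. z \<in> K \<Longrightarrow> norm (f z) \<le> \<delta>\<rbrakk>
          \<Longrightarrow> norm (L f) \<le> B * \<delta>"
  shows "L \<in> continuous_dual (compact_open_topology U)"
proof -
  let ?X = "compact_open_topology U"
  have diff: "L (\<lambda>z. g z - f z) = L g - L f"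
    if "f \<in> holomorphic_functions U" "g \<in> holomorphic_functions U" for f g
    using add[OF that(2) holomorphic_functions_cmult[OF that(1), of "-1"]] scale[OF that(1), of "-1"]
    by simp
  have "openin ?X {f \<in> topspace ?X. L f \<in> V}" if "open V" for V
  proof (subst openin_subopen, safe)
    fix f assume f: "f \<in> topspace ?X" "L f \<in> V"
    then obtain e where e: "e > 0" "ball (L f) e \<subseteq> V"
      using \<open>open V\<close> openE by blast
    \<comment> \<open>The sign of \<open>B\<close> is unknown; \<open>\<bar>B\<bar> + 1\<close> is a
      positive constant above it.\<close>
    define \<delta> where "\<delta> = e / (2 * (\<bar>B\<bar> + 1))"
    have "\<delta> > 0" using e by (simp add: \<delta>_def)
    obtain N where N: "openin ?X N" "f \<in> N" "\<And>g z. \<lbrakk>g \<in> N; z \<in> K\<rbrakk> \<Longrightarrow> norm (g z - f z) \<le> \<delta>"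
      using uniform_neighbourhood_compact_open[OF _ K \<open>\<delta> > 0\<close>] f(1)
      unfolding topspace_compact_open_topology by metis
    have "L g \<in> V" if g: "g \<in> N" for g
    proof -
      have "g \<in> holomorphic_functions U"
        using N(1) g openin_subset unfolding topspace_compact_open_topology[symmetric] by blast
      then have "norm (L g - L f) \<le> B * \<delta>"
        using bound[OF holomorphic_functions_diff \<open>\<delta> > 0\<close>, of g f] N(3)[OF g] f(1) diff
        by (simp add: topspace_compact_open_topology)
      also have "\<dots> \<le> (\<bar>B\<bar> + 1) * \<delta>"
        using \<open>\<delta> > 0\<close> by (intro mult_right_mono) auto
      also have "\<dots> = e/2"
        by (simp add: \<delta>_def field_simps)
      also have "\<dots> < e"
        using e by simp
      finally show ?thesis
        using e(2) by (auto simp: dist_norm norm_minus_commute subset_iff)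
    qed
    then have "N \<subseteq> {f \<in> topspace ?X. L f \<in> V}"
      using openin_subset[OF N(1)] by auto
    then show "\<exists>T. openin ?X T \<and> f \<in> T \<and> T \<subseteq> {f \<in> topspace ?X. L f \<in> V}"
      using N(1,2) by (intro exI[of _ N] conjI)
  qed
  then have "continuous_map ?X euclidean L"
    by (auto simp: continuous_map_def)
  then show ?thesis
    using add scale by (auto simp: continuous_dual_def topspace_compact_open_topology)
qed

subsection \<open>Composition operators\<close>

definition extend_zero :: "complex set \<Rightarrow> (complex \<Rightarrow> complex) \<Rightarrow> complex \<Rightarrow> complex" where
  "extend_zero U f = (\<lambda>z. if z \<in> U then f z else 0)"

text \<open>For \<open>f\<close> holomorphic on a punctured disc and \<open>h\<close> on the full
  disc around the circle, this is \<open>2 * pi * \<i>\<close> times the residue of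
  \<open>f * h\<close> at \<open>0\<close>, so it sees only the principal part of
  \<open>f\<close>.\<close>

definition circle_functional :: "real \<Rightarrow> (complex \<Rightarrow> complex) \<Rightarrow> (complex \<Rightarrow> complex) \<Rightarrow> complex" where
  "circle_functional r h f = contour_integral (circlepath 0 r) (\<lambda>z. f z * h z)"

lemma extend_zero_in_holomorphic_functions:
  "f holomorphic_on U \<Longrightarrow> extend_zero U f \<in> holomorphic_functions U"
  unfolding holomorphic_functions_def extend_zero_def
  by (auto intro: holomorphic_transform)

lemma eval_continuous_dual:
  assumes "a \<in> U"
  shows "(\<lambda>f. f a) \<in> continuous_dual (compact_open_topology U)"
  by (rule continuous_dual_compact_openI[of "{a}" _ _ 1]) (use assms in auto)

lemma eval_diff_continuous_dual:
  assumes "a \<in> U" "b \<in> U"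
  shows "(\<lambda>f. f a - f b) \<in> continuous_dual (compact_open_topology U)"
proof (rule continuous_dual_compact_openI[of "{a, b}" _ _ 2])
  fix f :: "complex \<Rightarrow> complex" and \<delta> :: real
  assume "\<And>z. z \<in> {a, b} \<Longrightarrow> norm (f z) \<le> \<delta>"
  from this[of a] this[of b] show "norm (f a - f b) \<le> 2 * \<delta>"
    by (simp add: norm_triangle_ineq4[THEN order_trans])
qed (use assms in \<open>auto simp: algebra_simps\<close>)

section \<open>Functionals given by integrals over a circle around 0\<close>

lemma circle_functional_integrable:
  assumes "f \<in> holomorphic_functions U" "sphere 0 r \<subseteq> U" "continuous_on (sphere 0 r) h" "r > 0"
  shows "(\<lambda>z. f z * h z) contour_integrable_on circlepath 0 r"
proof (rule contour_integrable_continuous_circlepath)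
  have "continuous_on (sphere 0 r) f"
    using assms holomorphic_on_imp_continuous_on[of f U] continuous_on_subset[of U f "sphere 0 r"]
    by (simp add: holomorphic_functions_def)
  then show "continuous_on (path_image (circlepath 0 r)) (\<lambda>z. f z * h z)"
    using assms by (auto intro!: continuous_intros)
qed

lemma circle_functional_continuous_dual:
  assumes "sphere 0 r \<subseteq> U" "continuous_on (sphere 0 r) h" "r > 0"
  shows "circle_functional r h \<in> continuous_dual (compact_open_topology U)"
proof -
  note int = circle_functional_integrable[OF _ assms]
  have "compact (h ` sphere 0 r)"
    using assms by (intro compact_continuous_image) auto
  then obtain B where "B > 0" and B: "\<And>z. z \<in> sphere 0 r \<Longrightarrow> norm (h z) \<le> B"
    by (metis bounded_pos compact_imp_bounded imageI)
  show ?thesis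
  proof (rule continuous_dual_compact_openI[of "sphere 0 r" _ _ "B * (2 * pi * r)"])
    fix f g assume fg: "f \<in> holomorphic_functions U" "g \<in> holomorphic_functions U"
    show "circle_functional r h (\<lambda>z. f z + g z) = circle_functional r h f + circle_functional r h g"
      using contour_integral_add[OF fg[THEN int]] by (simp add: circle_functional_def ring_distribs)
  next
    fix c f assume f: "f \<in> holomorphic_functions U"
    show "circle_functional r h (\<lambda>z. c * f z) = c * circle_functional r h f"
      using contour_integral_lmul[OF int[OF f]] by (simp add: circle_functional_def mult.assoc)
  next
    fix f \<delta> assume f: "f \<in> holomorphic_functions U" and "\<delta> > 0"
      and le: "\<And>z. z \<in> sphere 0 r \<Longrightarrow> norm (f z) \<le> \<delta>"
    have "norm (circle_functional r h f) \<le> (\<delta> * B) * (2 * pi * r)"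
      unfolding circle_functional_def
    proof (rule has_contour_integral_bound_circlepath[OF has_contour_integral_integral[OF int[OF f]]])
      fix x :: complex assume "norm (x - 0) = r"
      then show "norm (f x * h x) \<le> \<delta> * B"
        using le[of x] B[of x] \<open>\<delta> > 0\<close> by (auto simp: norm_mult intro!: mult_mono)
    qed (use \<open>\<delta> > 0\<close> \<open>B > 0\<close> assms in auto)
    then show "norm (circle_functional r h f) \<le> B * (2 * pi * r) * \<delta>"
      by (simp add: mult_ac)
  qed (use assms in auto)
qed

text \<open>Cauchy's integral formula at \<open>0\<close>, for evaluating functionals on test
  functions. A zero of the kernel \<open>k\<close> may cancel part of the pole of \<open>f\<close>,
  hence only the product is prescribed.\<close>

lemma circle_functional_simple_pole:
  assumes "h holomorphic_on V" "cball 0 r \<subseteq> V" "sphere 0 r \<subseteq> U" "r > 0"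
    and "\<And>z. z \<noteq> 0 \<Longrightarrow> f z * k z = h z / z"
  shows "circle_functional r k (extend_zero U f) = 2 * of_real pi * \<i> * h 0"
proof -
  have hol: "h holomorphic_on cball 0 r"
    using assms holomorphic_on_subset by blast
  have "((\<lambda>u. h u / (u - 0)) has_contour_integral (2 * of_real pi * \<i> * h 0)) (circlepath 0 r)"
    using hol assms by (intro Cauchy_integral_circlepath)
      (auto intro: holomorphic_on_imp_continuous_on holomorphic_on_subset)
  moreover have "circle_functional r k (extend_zero U f) = contour_integral (circlepath 0 r) (\<lambda>u. h u / (u - 0))"
    unfolding circle_functional_def
  proof (rule contour_integral_eq)
    fix z :: complex assume "z \<in> path_image (circlepath 0 r)"
    then have "z \<in> sphere 0 r" "z \<noteq> 0" using assms by auto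
    then show "extend_zero U f z * k z = h z / (z - 0)"
      using assms by (auto simp: extend_zero_def)
  qed
  ultimately show ?thesis
    using contour_integral_unique by force
qed

section \<open>Maps for which weak supercyclicity fails directly\<close>

lemma composition_operator_endo:
  assumes "\<phi> holomorphic_on U" "\<phi> ` U \<subseteq> U" "f \<in> topspace (compact_open_topology U)"
  shows "composition_operator U \<phi> f \<in> topspace (compact_open_topology U)"
  using assms composition_operator_in_holomorphic_functions
  by (simp add: topspace_compact_open_topology)

lemma weakly_supercyclic_imp_inj_on:
  assumes ws: "weakly_supercyclic (compact_open_topology U) (composition_operator U \<phi>)"
    and hol: "\<phi> holomorphic_on U" "\<phi> ` U \<subseteq> U" and "infinite U"
  shows "inj_on \<phi> U"
proof (rule ccontr)
  assume "\<not> inj_on \<phi> U"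
  then obtain a b where ab: "a \<in> U" "b \<in> U" "a \<noteq> b" "\<phi> a = \<phi> b"
    by (auto simp: inj_on_def)
  \<comment> \<open>A third point is needed: evaluation at \<open>c\<close> is the functional
    independent of the difference of evaluations.\<close>
  have "infinite (U - {a, b})"
    using \<open>infinite U\<close> by simp
  then obtain c where c: "c \<in> U" "c \<noteq> a" "c \<noteq> b"
    by (metis Diff_iff ex_in_conv finite.emptyI insertCI)
  \<comment> \<open>Of the three points, \<open>g\<close> vanishes exactly at \<open>b\<close> and
    \<open>c\<close>, and \<open>h\<close> exactly at \<open>b\<close>.\<close>
  have "\<not> weakly_supercyclic (compact_open_topology U) (composition_operator U \<phi>)"
  proof (rule not_weakly_supercyclic_annihilator[where L = "\<lambda>f. f a - f b" and M = "\<lambda>f. f c"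
        and g = "extend_zero U (\<lambda>z. (z - b) * (z - c))" and h = "extend_zero U (\<lambda>z. z - b)"])
    show "extend_zero U (\<lambda>z. (z - b) * (z - c)) \<in> topspace (compact_open_topology U)"
      "extend_zero U (\<lambda>z. z - b) \<in> topspace (compact_open_topology U)"
      unfolding topspace_compact_open_topology
      by (auto intro!: extend_zero_in_holomorphic_functions holomorphic_intros)
    show "composition_operator U \<phi> f \<in> topspace (compact_open_topology U)"
      if "f \<in> topspace (compact_open_topology U)" for f
      using composition_operator_endo hol that by blast
  qed (use ab c in \<open>auto simp: composition_operator_def extend_zero_def eval_continuous_dual eval_diff_continuous_dual\<close>)
  with ws show False by blast
qed

text \<open>Evaluation at a fixed point is an eigenfunctional with eigenvalue \<open>1\<close>, and
  evaluations at distinct points are separated by linear polynomials.\<close>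

lemma not_weakly_supercyclic_two_fixed_points:
  assumes "\<phi> holomorphic_on U" "\<phi> ` U \<subseteq> U"
    and "a \<in> U" "b \<in> U" "a \<noteq> b" "\<phi> a = a" "\<phi> b = b"
  shows "\<not> weakly_supercyclic (compact_open_topology U) (composition_operator U \<phi>)"
proof (rule not_weakly_supercyclic_two_eigenfunctionals[where L = "\<lambda>f. f a" and M = "\<lambda>f. f b"
      and \<alpha> = 1 and \<beta> = 1
      and g = "extend_zero U (\<lambda>z. z - b)" and h = "extend_zero U (\<lambda>z. z - a)"])
  show "extend_zero U (\<lambda>z. z - b) \<in> topspace (compact_open_topology U)"
    "extend_zero U (\<lambda>z. z - a) \<in> topspace (compact_open_topology U)"
    unfolding topspace_compact_open_topology
    by (auto intro!: extend_zero_in_holomorphic_functions holomorphic_intros)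
  show "composition_operator U \<phi> f \<in> topspace (compact_open_topology U)"
    if "f \<in> topspace (compact_open_topology U)" for f
    using composition_operator_endo assms that by blast
qed (use assms in \<open>auto simp: composition_operator_def extend_zero_def eval_continuous_dual\<close>)

text \<open>Near \<open>0\<close> the function \<open>f \<circ> \<phi>\<close> agrees with
  \<open>f \<circ> \<psi>\<close>, which is holomorphic at \<open>0\<close>: composition removes the
  singularity, so the principal part at \<open>0\<close> is annihilated.\<close>

lemma not_weakly_supercyclic_extends_into:
  assumes U: "open U" "0 \<notin> U" and hol: "\<phi> holomorphic_on U" "\<phi> ` U \<subseteq> U"
    and r: "r > 0" "ball 0 r - {0} \<subseteq> U" and \<psi>: "\<psi> holomorphic_on ball 0 r" "\<psi> 0 \<in> U"
    and eq: "\<And>z. z \<in> ball 0 r - {0} \<Longrightarrow> \<psi> z = \<phi> z"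
  shows "\<not> weakly_supercyclic (compact_open_topology U) (composition_operator U \<phi>)"
proof -
  have "open (ball 0 r \<inter> \<psi> -` U)"
    using \<psi> U by (intro continuous_open_preimage holomorphic_on_imp_continuous_on) auto
  moreover have "0 \<in> ball 0 r \<inter> \<psi> -` U"
    using \<psi> r by simp
  ultimately obtain s where s: "s > 0" "ball 0 s \<subseteq> ball 0 r \<inter> \<psi> -` U"
    by (rule openE)
  define t where "t = s / 2"
  have t: "t > 0" "t < s" using s by (auto simp: t_def)
  have sphere: "sphere 0 t \<subseteq> U"
  proof
    fix z :: complex assume "z \<in> sphere 0 t"
    then have "z \<in> ball 0 s" "z \<noteq> 0" using t by auto
    then show "z \<in> U" using s r by auto
  qed
  have kill: "circle_functional t k (composition_operator U \<phi> f) = 0"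
    if f: "f \<in> holomorphic_functions U" and k: "k holomorphic_on UNIV" for f k
  proof -
    have "(\<lambda>z. (f \<circ> \<psi>) z * k z) holomorphic_on ball 0 s"
    proof (intro holomorphic_intros holomorphic_on_compose_gen)
      show "\<psi> holomorphic_on ball 0 s" "\<psi> ` ball 0 s \<subseteq> U"
        using s \<psi> by (auto intro: holomorphic_on_subset)
      show "f holomorphic_on U" using f by (simp add: holomorphic_functions_def)
      show "k holomorphic_on ball 0 s" using k holomorphic_on_subset by blast
    qed
    then have "((\<lambda>z. (f \<circ> \<psi>) z * k z) has_contour_integral 0) (circlepath 0 t)"
      using t by (intro Cauchy_theorem_convex_simple[of _ "ball 0 s"]) auto
    then have "contour_integral (circlepath 0 t) (\<lambda>z. (f \<circ> \<psi>) z * k z) = 0"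
      by (rule contour_integral_unique)
    moreover have "circle_functional t k (composition_operator U \<phi> f)
        = contour_integral (circlepath 0 t) (\<lambda>z. (f \<circ> \<psi>) z * k z)"
      unfolding circle_functional_def
    proof (rule contour_integral_eq)
      fix z :: complex assume "z \<in> path_image (circlepath 0 t)"
      then have "z \<in> sphere 0 t" "z \<in> ball 0 s" "z \<noteq> 0" using t by auto
      then show "composition_operator U \<phi> f z * k z = (f \<circ> \<psi>) z * k z"
        using sphere eq s by (auto simp: composition_operator_def)
    qed
    ultimately show ?thesis by simp
  qed
  have hol_inverse: "extend_zero U (\<lambda>z. 1 / z ^ n) \<in> holomorphic_functions U" for n
    using U by (intro extend_zero_in_holomorphic_functions holomorphic_intros) auto
  \<comment> \<open>Both eigenvalues are \<open>0\<close>. Up to a constant, the functionals read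
    off the Laurent coefficients of \<open>1 / z\<close> and \<open>1 / z ^ 2\<close>.\<close>
  show ?thesis
  proof (rule not_weakly_supercyclic_two_eigenfunctionals[where L = "circle_functional t (\<lambda>z. 1)"
        and M = "circle_functional t (\<lambda>z. z)" and \<alpha> = 0 and \<beta> = 0
        and g = "extend_zero U (\<lambda>z. 1 / z ^ 1)" and h = "extend_zero U (\<lambda>z. 1 / z ^ 2)"])
    have "circle_functional t (\<lambda>z. 1) (extend_zero U (\<lambda>z. 1 / z ^ 1)) = 2 * of_real pi * \<i> * 1"
      by (rule circle_functional_simple_pole[of "\<lambda>z. 1" UNIV]) (use t sphere in auto)
    then show "circle_functional t (\<lambda>z. 1) (extend_zero U (\<lambda>z. 1 / z ^ 1)) \<noteq> 0" by simp
    have "circle_functional t (\<lambda>z. z) (extend_zero U (\<lambda>z. 1 / z ^ 1)) = 2 * of_real pi * \<i> * 0"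
      by (rule circle_functional_simple_pole[of "\<lambda>z. z" UNIV]) (use t sphere in auto)
    then show "circle_functional t (\<lambda>z. z) (extend_zero U (\<lambda>z. 1 / z ^ 1)) = 0" by simp
    have "circle_functional t (\<lambda>z. z) (extend_zero U (\<lambda>z. 1 / z ^ 2)) = 2 * of_real pi * \<i> * 1"
      by (rule circle_functional_simple_pole[of "\<lambda>z. 1" UNIV])
        (use t sphere in \<open>auto simp: power2_eq_square\<close>)
    then show "circle_functional t (\<lambda>z. z) (extend_zero U (\<lambda>z. 1 / z ^ 2)) \<noteq> 0" by simp
  qed (use hol kill hol_inverse hol_inverse[of 1] sphere t in \<open>simp_all add: composition_operator_endo
      topspace_compact_open_topology circle_functional_continuous_dual
      composition_operator_in_holomorphic_functions\<close>)
qed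

subsection \<open>Injective maps and linearization\<close>

text \<open>
  The residue at \<open>0\<close> is invariant under a holomorphic change of coordinates: the image of the
  circle winds once around \<open>0\<close>.
\<close>

lemma contour_integral_circlepath_substitution:
  assumes V: "open V" "convex V" "0 \<in> V" and r: "r > 0" "sphere 0 r \<subseteq> V"
    and \<psi>: "\<psi> holomorphic_on V" "\<psi> ` V \<subseteq> V" "\<And>z. z \<in> V \<Longrightarrow> \<psi> z = 0 \<longleftrightarrow> z = 0" "deriv \<psi> 0 \<noteq> 0"
    and F: "F holomorphic_on V - {0}"
  shows "contour_integral (circlepath 0 r) (\<lambda>z. deriv \<psi> z * F (\<psi> z)) = contour_integral (circlepath 0 r) F"
proof -
  let ?\<gamma> = "circlepath 0 r"
  have conn: "connected V" using V convex_connected by blast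
  have sphere: "path_image ?\<gamma> \<subseteq> V - {0}" using r by auto
  have ana: "\<psi> analytic_on V" using V \<psi> by (simp add: analytic_on_open)
  have path: "valid_path (\<psi> \<circ> ?\<gamma>)" "pathfinish (\<psi> \<circ> ?\<gamma>) = pathstart (\<psi> \<circ> ?\<gamma>)"
    "path_image (\<psi> \<circ> ?\<gamma>) \<subseteq> V - {0}"
    using valid_path_compose_holomorphic[of ?\<gamma> \<psi> V] \<psi> V r
    by (auto simp: pathfinish_compose pathstart_compose path_image_compose)
  \<comment> \<open>Convexity of \<open>V\<close> makes the winding numbers about points outside
    \<open>V\<close> vanish, so both integrals depend only on the winding number about
    \<open>0\<close>.\<close>
  have residue: "contour_integral g F = 2 * pi * \<i> * (\<Sum>p\<in>{0}. winding_number g p * residue F p)"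
    if "valid_path g" "pathfinish g = pathstart g" "path_image g \<subseteq> V - {0}" for g
  proof (rule Residue_theorem[OF V(1) conn _ F that])
    show "\<forall>z. z \<notin> V \<longrightarrow> winding_number g z = 0"
      using winding_number_zero_outside[of g V] V that valid_path_imp_path by blast
  qed simp
  have "winding_number (\<psi> \<circ> ?\<gamma>) 0 = 1 / (2 * pi * \<i>) * contour_integral ?\<gamma> (\<lambda>z. deriv \<psi> z * (1 / \<psi> z))"
    using winding_number_valid_path[of "\<psi> \<circ> ?\<gamma>" 0] path
      contour_integral_comp_analyticW[OF ana, of ?\<gamma> "\<lambda>w. 1 / w"] r by auto
  moreover have "contour_integral ?\<gamma> (\<lambda>z. deriv \<psi> z * (1 / \<psi> z)) = 2 * pi * \<i>"
  proof -
    \<comment> \<open>With \<open>\<psi> z = z * k z\<close> and \<open>k\<close> zero-free on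
      \<open>V\<close>, the logarithmic derivative of \<open>\<psi>\<close> is
      \<open>1 / z + deriv k z / k z\<close>; the second term integrates to \<open>0\<close> by
      Cauchy's theorem.\<close>
    define k where "k = (\<lambda>z. if z = 0 then deriv \<psi> 0 else (\<psi> z - \<psi> 0) / (z - 0))"
    have k: "k holomorphic_on V"
      unfolding k_def using \<psi> V by (intro pole_lemma_open)
    have \<psi>k: "\<psi> z = z * k z" if "z \<in> V" for z
      using \<psi>(3)[of 0] \<psi>(3)[OF that] V by (auto simp: k_def)
    have k0: "k z \<noteq> 0" if "z \<in> V" for z
      using \<psi>(3)[OF that] \<psi>(3)[of 0] \<psi>(4) V by (auto simp: k_def)
    have "(\<lambda>z. deriv k z / k z) holomorphic_on V"
      using k k0 V by (intro holomorphic_intros)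
    then have "((\<lambda>z. deriv k z / k z) has_contour_integral 0) ?\<gamma>"
      using V r by (intro Cauchy_theorem_convex_simple[of _ V]) auto
    moreover have "((\<lambda>z. 1 / (z - 0)) has_contour_integral 2 * pi * \<i> * winding_number ?\<gamma> 0) ?\<gamma>"
      using r by (intro has_contour_integral_winding_number) auto
    ultimately have "((\<lambda>z. 1 / (z - 0) + deriv k z / k z) has_contour_integral 2 * pi * \<i> * winding_number ?\<gamma> 0 + 0) ?\<gamma>"
      by (rule has_contour_integral_add[rotated])
    moreover have "1 / (z - 0) + deriv k z / k z = deriv \<psi> z * (1 / \<psi> z)" if "z \<in> path_image ?\<gamma>" for z
    proof -
      have z: "z \<in> V" "z \<noteq> 0" using that sphere by auto
      have "((\<lambda>z. z * k z) has_field_derivative (z * deriv k z + 1 * k z)) (at z)"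
        using holomorphic_derivI[OF k V(1) z(1)] by (intro derivative_eq_intros) auto
      then have "(\<psi> has_field_derivative (z * deriv k z + 1 * k z)) (at z)"
        by (rule has_field_derivative_transform_within_open[OF _ V(1) z(1)]) (simp add: \<psi>k)
      then have "deriv \<psi> z = z * deriv k z + k z"
        by (simp add: DERIV_imp_deriv)
      then show ?thesis
        using z k0[OF z(1)] by (simp add: \<psi>k field_simps)
    qed
    ultimately have "((\<lambda>z. deriv \<psi> z * (1 / \<psi> z)) has_contour_integral 2 * pi * \<i> * winding_number ?\<gamma> 0 + 0) ?\<gamma>"
      by (rule has_contour_integral_eq)
    then show ?thesis
      using r by (simp add: winding_number_circlepath_centre contour_integral_unique)
  qed
  ultimately have "winding_number (\<psi> \<circ> ?\<gamma>) 0 = winding_number ?\<gamma> 0"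
    using r by (simp add: winding_number_circlepath_centre)
  then have "contour_integral (\<psi> \<circ> ?\<gamma>) F = contour_integral ?\<gamma> F"
    using residue[OF path] residue[of ?\<gamma>] sphere by simp
  then show ?thesis
    using contour_integral_comp_analyticW[OF ana, of ?\<gamma> F] r by auto
qed

text \<open>Writing \<open>\<psi> z = l * z * exp (u z)\<close> with \<open>u 0 = 0\<close>, the sum
  \<open>S\<close> of \<open>u\<close> along the forward orbit satisfies
  \<open>S z = u z + S (\<psi> z)\<close>, and \<open>z * exp (S z)\<close> is the Koenigs function.
  Iterates decay geometrically, so the sum converges. Stating the result for
  \<open>\<tau> z = exp (S z)\<close> records that the zero at \<open>0\<close> is simple.\<close>

lemma Koenigs_linearization:
  fixes \<psi> :: "complex \<Rightarrow> complex"
  assumes V: "open V" "0 \<in> V" and \<psi>: "\<psi> holomorphic_on V" "\<psi> 0 = 0"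
    and l: "deriv \<psi> 0 \<noteq> 0" "norm (deriv \<psi> 0) < 1"
  obtains r \<tau> where "r > 0" "ball 0 r \<subseteq> V" "\<psi> ` ball 0 r \<subseteq> ball 0 r"
    "\<tau> holomorphic_on ball 0 r" "\<tau> 0 \<noteq> 0"
    "\<And>z. z \<in> ball 0 r \<Longrightarrow> \<psi> z * \<tau> (\<psi> z) = deriv \<psi> 0 * (z * \<tau> z)"
proof -
  define l where "l = deriv \<psi> 0"
  define k where "k = (\<lambda>z. if z = 0 then l else (\<psi> z - \<psi> 0) / (z - 0))"
  have k: "k holomorphic_on V"
    unfolding k_def l_def using \<psi> V by (intro pole_lemma_open)
  have \<psi>k: "\<psi> z = z * k z" for z
    using \<psi> by (auto simp: k_def)
  \<comment> \<open>The midpoint of \<open>norm l\<close> and \<open>1\<close>, a contraction factor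
    for \<open>\<psi>\<close> near \<open>0\<close>.\<close>
  define \<rho> where "\<rho> = (1 + norm l) / 2"
  have \<rho>: "norm l < \<rho>" "\<rho> < 1" "\<rho> > 0"
    using \<open>norm (deriv \<psi> 0) < 1\<close> by (auto simp: \<rho>_def l_def intro: add_pos_nonneg)
  have [simp]: "l \<noteq> 0" using l by (simp add: l_def)
  \<comment> \<open>The first ball yields the contraction; the second keeps \<open>k z / l\<close>
    in the right half-plane, where \<open>Ln\<close> is holomorphic.\<close>
  let ?A = "(ball 0 \<rho> \<inter> ball l (norm l)) :: complex set"
  have "open (V \<inter> k -` ?A)"
    using k V by (intro continuous_open_preimage holomorphic_on_imp_continuous_on) auto
  moreover have "0 \<in> V \<inter> k -` ?A"
    using V \<rho> by (simp add: k_def)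
  ultimately obtain r1 where r1: "r1 > 0" "ball 0 r1 \<subseteq> V \<inter> k -` ?A"
    by (rule openE)
  define u where "u = (\<lambda>z. Ln (k z / l))"
  have hol_u: "u holomorphic_on ball 0 r1"
    unfolding u_def
  proof (intro holomorphic_intros)
    show "k holomorphic_on ball 0 r1" using k r1 holomorphic_on_subset by blast
    fix z :: complex assume "z \<in> ball 0 r1"
    then have "norm (l - k z) < norm l" using r1 by (auto simp: dist_norm)
    then have "norm (1 - k z / l) < 1"
      by (metis \<open>l \<noteq> 0\<close> diff_divide_distrib divide_less_eq_1_pos divide_self norm_divide zero_less_norm_iff)
    then have "Re (1 - k z / l) < 1"
      using complex_Re_le_cmod order_le_less_trans by blast
    then show "k z / l \<notin> \<real>\<^sub>\<le>\<^sub>0"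
      by (auto simp: complex_nonpos_Reals_iff)
  qed auto
  have exp_u: "k z = l * exp (u z)" if "z \<in> ball 0 r1" for z
  proof -
    have "k z \<noteq> 0" using that r1 by auto
    then show ?thesis by (simp add: u_def)
  qed
  have "u 0 = 0" by (simp add: u_def k_def)
  \<comment> \<open>The quotient \<open>u z / z\<close>, bounded on a smaller closed disc, gives
    \<open>norm (u z) \<le> norm z * B\<close> there.\<close>
  define v where "v = (\<lambda>z. if z = 0 then deriv u 0 else (u z - u 0) / (z - 0))"
  have v: "v holomorphic_on ball 0 r1"
    unfolding v_def by (intro pole_lemma_open hol_u) auto
  define r where "r = r1 / 2"
  have r: "r > 0" "cball 0 r \<subseteq> ball 0 r1" using r1 by (auto simp: r_def)
  have r_V: "ball 0 r \<subseteq> V" using r r1 ball_subset_cball by blast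
  have "compact (v ` cball 0 r)"
    using v r by (intro compact_continuous_image holomorphic_on_imp_continuous_on)
      (auto intro: holomorphic_on_subset)
  then obtain B where "B > 0" and B: "\<And>z. z \<in> cball 0 r \<Longrightarrow> norm (v z) \<le> B"
    by (metis bounded_pos compact_imp_bounded imageI)
  have u_le: "norm (u z) \<le> norm z * B" if "z \<in> cball 0 r" for z
  proof -
    have "u z = z * v z" using \<open>u 0 = 0\<close> by (auto simp: v_def)
    then show ?thesis using B[OF that] by (simp add: norm_mult mult_left_mono)
  qed
  have \<psi>_le: "norm (\<psi> z) \<le> norm z * \<rho>" if "z \<in> ball 0 r" for z
  proof -
    have "z \<in> ball 0 r1" using that r1 by (auto simp: r_def)
    then have "k z \<in> ball 0 \<rho>" using r1 by blast
    then have "norm (k z) \<le> \<rho>" by simp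
    then show ?thesis by (simp add: \<psi>k norm_mult mult_left_mono)
  qed
  have \<psi>_ball: "\<psi> ` ball 0 r \<subseteq> ball 0 r"
  proof clarify
    fix z :: complex assume z: "z \<in> ball 0 r"
    have "norm (\<psi> z) \<le> norm z * 1"
      using \<psi>_le[OF z] \<rho> by (meson less_imp_le mult_left_mono norm_ge_zero order_trans)
    then show "\<psi> z \<in> ball 0 r" using z by simp
  qed
  have iter: "(\<psi> ^^ n) z \<in> ball 0 r \<and> norm ((\<psi> ^^ n) z) \<le> r * \<rho> ^ n" if "z \<in> ball 0 r" for n z
  proof (induction n)
    case (Suc n)
    then have "norm (\<psi> ((\<psi> ^^ n) z)) \<le> norm ((\<psi> ^^ n) z) * \<rho>"
      using \<psi>_le by blast
    also have "\<dots> \<le> r * \<rho> ^ n * \<rho>" using Suc \<rho> by (intro mult_right_mono) auto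
    finally show ?case using Suc \<psi>_ball by (simp add: image_subset_iff mult_ac)
  qed (use that in auto)
  have hol_iter: "(\<psi> ^^ n) holomorphic_on ball 0 r" for n
  proof (induction n)
    case (Suc n)
    have "\<psi> \<circ> (\<psi> ^^ n) holomorphic_on ball 0 r"
      by (rule holomorphic_on_compose_gen[OF Suc holomorphic_on_subset[OF \<psi>(1) r_V]])
        (use iter in blast)
    then show ?case by (simp add: o_def)
  qed (auto simp: id_def)
  have u_iter: "norm (u ((\<psi> ^^ n) z)) \<le> B * r * \<rho> ^ n" if "z \<in> ball 0 r" for n z
  proof -
    have "norm (u ((\<psi> ^^ n) z)) \<le> norm ((\<psi> ^^ n) z) * B"
      using u_le iter[OF that] by (meson ball_subset_cball subsetD)
    also have "\<dots> \<le> r * \<rho> ^ n * B"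
      using iter[OF that] \<open>B > 0\<close> by (intro mult_right_mono) auto
    finally show ?thesis by (simp add: mult_ac)
  qed
  have sm: "summable (\<lambda>n. B * r * \<rho> ^ n)"
    using \<rho> by (intro summable_mult summable_geometric) auto
  define S where "S = (\<lambda>z. \<Sum>n. u ((\<psi> ^^ n) z))"
  have unif: "uniform_limit (ball 0 r) (\<lambda>n z. \<Sum>i<n. u ((\<psi> ^^ i) z)) S sequentially"
    unfolding S_def by (rule Weierstrass_m_test[OF _ sm]) (rule u_iter)
  have "S holomorphic_on ball 0 r"
  proof (rule holomorphic_uniform_sequence[of _ "\<lambda>n z. \<Sum>i<n. u ((\<psi> ^^ i) z)"])
    fix n
    have "u \<circ> (\<psi> ^^ i) holomorphic_on ball 0 r" for i
      by (rule holomorphic_on_compose_gen[OF hol_iter hol_u]) (use iter r ball_subset_cball in blast)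
    then show "(\<lambda>z. \<Sum>i<n. u ((\<psi> ^^ i) z)) holomorphic_on ball 0 r"
      by (intro holomorphic_on_sum) (simp add: o_def)
  next
    fix x :: complex assume "x \<in> ball 0 r"
    then obtain d where "d > 0" "cball x d \<subseteq> ball 0 r"
      using open_contains_cball[of "ball (0::complex) r"] by blast
    then show "\<exists>d>0. cball x d \<subseteq> ball 0 r \<and>
        uniform_limit (cball x d) (\<lambda>n z. \<Sum>i<n. u ((\<psi> ^^ i) z)) S sequentially"
      using uniform_limit_on_subset[OF unif] by blast
  qed auto
  moreover have "\<psi> z * exp (S (\<psi> z)) = l * (z * exp (S z))" if z: "z \<in> ball 0 r" for z
  proof -
    have "summable (\<lambda>n. u ((\<psi> ^^ n) z))"
      using u_iter[OF z] by (intro summable_comparison_test[OF _ sm]) auto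
    from suminf_split_head[OF this] have "S z = u z + S (\<psi> z)"
      by (simp add: S_def funpow_swap1)
    then have "exp (S z) = exp (u z) * exp (S (\<psi> z))"
      by (simp add: exp_add)
    moreover have "k z = l * exp (u z)" using z r ball_subset_cball by (intro exp_u) blast
    ultimately show ?thesis
      by (simp add: \<psi>k[of z] mult_ac)
  qed
  ultimately show ?thesis
    using r r_V \<psi>_ball by (intro that[of r "\<lambda>z. exp (S z)"]) (auto simp: l_def intro: holomorphic_intros)
qed

section \<open>Injective maps of the plane and of the punctured plane\<close>

text \<open>The function \<open>z / h z\<close> extends to a zero-free entire function. It grows at
  most linearly because \<open>h\<close> stays away from \<open>0\<close> outside the unit disc, so
  it is affine, hence constant.\<close>

lemma injective_entire_linear:
  assumes hol: "h holomorphic_on UNIV" and inj: "inj h" and "h 0 = 0"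
  obtains a where "a \<noteq> 0" "\<And>z. h z = a * z"
proof -
  have h0: "h z \<noteq> 0" if "z \<noteq> 0" for z
    using inj \<open>h 0 = 0\<close> that by (metis injD)
  have d0: "deriv h 0 \<noteq> 0"
    using holomorphic_injective_imp_regular[OF hol _ inj, of 0] by simp
  have "open (h ` ball 0 1)"
    using hol inj by (intro open_mapping_thm3) (auto intro: holomorphic_on_subset inj_on_subset)
  then obtain e where e: "e > 0" "ball 0 e \<subseteq> h ` ball 0 1"
    using \<open>h 0 = 0\<close> by (metis centre_in_ball imageI openE zero_less_one)
  \<comment> \<open>The values near \<open>0\<close> are already taken inside the unit disc, and
    \<open>h\<close> is injective.\<close>
  have ge: "norm (h z) \<ge> e" if "norm z \<ge> 1" for z
  proof (rule ccontr)
    assume "\<not> norm (h z) \<ge> e"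
    then have "h z \<in> h ` ball 0 1" using e by auto
    then have "z \<in> ball 0 1" using inj by (simp add: inj_image_mem_iff)
    then show False using that by simp
  qed
  define k where "k = (\<lambda>z. if z = 0 then deriv h 0 else (h z - h 0) / (z - 0))"
  have k: "k holomorphic_on UNIV"
    unfolding k_def by (intro pole_lemma_open hol) auto
  have k0: "k z \<noteq> 0" for z
    using d0 h0 \<open>h 0 = 0\<close> by (auto simp: k_def)
  have hk: "h z = z * k z" for z
    using \<open>h 0 = 0\<close> by (simp add: k_def)
  define q where "q = (\<lambda>z. 1 / k z)"
  have q: "q holomorphic_on UNIV"
    unfolding q_def using k k0 by (intro holomorphic_intros) auto
  have "norm (q z) \<le> (1 / e) * norm z ^ 1" if "1 \<le> norm z" for z
  proof -
    have "z \<noteq> 0" using that by auto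
    then have "q z = z / h z" by (simp add: q_def hk)
    then show ?thesis
      using ge[OF that] e by (simp add: norm_divide frac_le)
  qed
  then have lin: "q z = q 0 + deriv q 0 * z" for z
    using Liouville_polynomial[OF q, of 1 "1 / e" 1 z] by simp
  have "deriv q 0 = 0"
  proof (rule ccontr)
    assume "deriv q 0 \<noteq> 0"
    then have "q (- q 0 / deriv q 0) = 0" by (subst lin) simp
    then show False using k0 by (simp add: q_def)
  qed
  then have "q z = q 0" for z using lin[of z] by simp
  then have "k z = k 0" for z by (simp add: q_def)
  then show ?thesis
    using k0 hk by (intro that[of "k 0"]) (auto simp: mult.commute)
qed

lemma tendsto_imp_eventually_norm_le:
  fixes f :: "'a \<Rightarrow> 'b::real_normed_vector"
  assumes "(f \<longlongrightarrow> l) F"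
  shows "\<exists>B. \<forall>\<^sub>F x in F. norm (f x) \<le> B"
proof -
  have "\<forall>\<^sub>F x in F. norm (f x) < norm l + 1"
    by (rule order_tendstoD(2)[OF tendsto_norm[OF assms]]) simp
  then have "\<forall>\<^sub>F x in F. norm (f x) \<le> norm l + 1"
    by eventually_elim simp
  then show ?thesis ..
qed

text \<open>
  The image of \<open>\<bar>z\<bar> > 1\<close> is open, so by injectivity the values on the punctured disc
  stay away from some point: the singularity at \<open>0\<close> is not essential.
\<close>

lemma injective_punctured_plane_extends:
  fixes \<phi> :: "complex \<Rightarrow> complex"
  assumes hol: "\<phi> holomorphic_on UNIV - {0}" and inj: "inj_on \<phi> (UNIV - {0})"
    and nz: "\<And>z. z \<noteq> 0 \<Longrightarrow> \<phi> z \<noteq> 0"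
  obtains \<psi> where "\<psi> holomorphic_on UNIV" "\<And>z. z \<noteq> 0 \<Longrightarrow> \<psi> z = \<phi> z"
  | \<psi> where "\<psi> holomorphic_on UNIV" "\<psi> 0 = 0" "\<And>z. z \<noteq> 0 \<Longrightarrow> \<psi> z = 1 / \<phi> z"
proof -
  have "open (\<phi> ` (- cball 0 1))"
    using hol inj by (intro open_mapping_thm3) (auto intro!: holomorphic_on_subset[OF hol] inj_on_subset[OF inj])
  \<comment> \<open>Any point outside the closed unit disc would do; its image becomes the centre
    \<open>w\<close> of a ball that \<open>\<phi>\<close> avoids on the punctured disc.\<close>
  moreover have "\<phi> 2 \<in> \<phi> ` (- cball 0 1)" by auto
  ultimately obtain w e where e: "e > 0" "ball w e \<subseteq> \<phi> ` (- cball 0 1)"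
    by (rule openE)
  have far: "norm (\<phi> z - w) \<ge> e" if z: "z \<in> ball 0 1 - {0}" for z
  proof (rule ccontr)
    assume "\<not> norm (\<phi> z - w) \<ge> e"
    then have "\<phi> z \<in> \<phi> ` (- cball 0 1)"
      using e by (auto simp: dist_norm norm_minus_commute)
    then obtain y where "y \<in> - cball 0 1" and "\<phi> z = \<phi> y" ..
    then have "norm y > 1" by simp
    then have "y \<noteq> 0" by auto
    then show False
      using z \<open>norm y > 1\<close> \<open>\<phi> z = \<phi> y\<close> inj_onD[OF inj, of z y] by auto
  qed
  define q where "q = (\<lambda>z. 1 / (\<phi> z - w))"
  have "q holomorphic_on ball 0 1 - {0}"
    unfolding q_def using far e
    by (intro holomorphic_intros holomorphic_on_subset[OF hol]) force+
  moreover have "\<forall>\<^sub>F z in at 0. norm (q z) \<le> 1 / e"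
    unfolding eventually_at using far e
    by (intro exI[of _ 1]) (auto simp: q_def norm_divide intro!: frac_le)
  ultimately obtain g where g: "g holomorphic_on ball 0 1" "\<And>z. z \<in> ball 0 1 - {0} \<Longrightarrow> g z = q z"
    using holomorphic_on_extend_bounded[of q "ball 0 1" 0] by auto
  have cont: "isCont g 0"
    using g(1) by (intro continuous_on_interior[of "ball 0 1"] holomorphic_on_imp_continuous_on) auto
  have near: "\<forall>\<^sub>F z in at 0. z \<in> ball 0 1 - {0 :: complex}"
    unfolding eventually_at by (intro exI[of _ 1]) auto
  have \<phi>w: "\<phi> z \<noteq> w" if "z \<in> ball 0 1 - {0}" for z
    using far[OF that] e by auto
  show ?thesis
  proof (cases "g 0 = 0")
    \<comment> \<open>Here \<open>\<phi> = w + 1 / g\<close> stays bounded near \<open>0\<close>: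
      the singularity is removable.\<close>
    case False
    have lim: "((\<lambda>z. w + 1 / g z) \<longlongrightarrow> w + 1 / g 0) (at 0)"
      using cont False by (auto intro!: tendsto_intros simp: isCont_def)
    have "\<forall>\<^sub>F z in at 0. w + 1 / g z = \<phi> z"
      using near by eventually_elim (use g(2) \<phi>w in \<open>simp add: q_def\<close>)
    with lim have "(\<phi> \<longlongrightarrow> w + 1 / g 0) (at 0)"
      by (rule Lim_transform_eventually)
    then have "\<exists>B. \<forall>\<^sub>F z in at 0. norm (\<phi> z) \<le> B"
      by (rule tendsto_imp_eventually_norm_le)
    then obtain \<psi> where "\<psi> holomorphic_on UNIV" "\<forall>z\<in>UNIV - {0}. \<psi> z = \<phi> z"
      using holomorphic_on_extend_bounded[OF hol] by auto
    then show ?thesis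
      by (intro that(1)[of \<psi>]) auto
  next
    \<comment> \<open>Here \<open>\<phi>\<close> has a pole. Solving
      \<open>g = 1 / (\<phi> - w)\<close> gives \<open>1 / \<phi> = g / (1 + w * g)\<close>, which
      tends to \<open>0\<close>.\<close>
    case True
    have lim: "((\<lambda>z. g z / (1 + w * g z)) \<longlongrightarrow> g 0 / (1 + w * g 0)) (at 0)"
      using cont True by (intro tendsto_intros) (auto simp: isCont_def)
    have "\<forall>\<^sub>F z in at 0. g z / (1 + w * g z) = 1 / \<phi> z"
      using near
    proof eventually_elim
      case (elim z)
      then have "1 + w * g z = \<phi> z * g z"
        using g(2) \<phi>w by (simp add: q_def field_simps)
      moreover have "g z \<noteq> 0"
        using elim g(2) \<phi>w by (simp add: q_def)
      ultimately show ?case by simp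
    qed
    with lim have lim': "((\<lambda>z. 1 / \<phi> z) \<longlongrightarrow> 0) (at 0)"
      using True by (simp add: Lim_transform_eventually)
    then have "\<exists>B. \<forall>\<^sub>F z in at 0. norm (1 / \<phi> z) \<le> B"
      by (rule tendsto_imp_eventually_norm_le)
    moreover have "(\<lambda>z. 1 / \<phi> z) holomorphic_on UNIV - {0}"
      using nz by (intro holomorphic_intros hol) auto
    ultimately obtain \<psi> where \<psi>: "\<psi> holomorphic_on UNIV" "\<And>z. z \<noteq> 0 \<Longrightarrow> \<psi> z = 1 / \<phi> z"
      using holomorphic_on_extend_bounded[of "\<lambda>z. 1 / \<phi> z" UNIV 0] by auto
    have "\<psi> \<midarrow>0\<rightarrow> \<psi> 0"
      using \<psi>(1) continuous_on_interior[of UNIV \<psi> 0] holomorphic_on_imp_continuous_on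
      by (auto simp: isCont_def)
    moreover have "\<psi> \<midarrow>0\<rightarrow> 0"
      using \<psi>(2) by (intro Lim_transform_eventually[OF lim']) (auto simp: eventually_at intro!: exI[of _ 1])
    ultimately have "\<psi> 0 = 0"
      by (rule tendsto_unique[rotated]) simp
    with \<psi> show ?thesis
      by (intro that(2)[of \<psi>]) auto
  qed
qed

subsection \<open>The punctured disc and the punctured plane\<close>

text \<open>The condition on \<open>h\<close> says that \<open>\<psi>\<close> pulls the differential
  \<open>h dz\<close> back to \<open>\<mu> h dz\<close>. The integral of
  \<open>(f \<circ> \<psi>) h dz\<close> is then \<open>1 / \<mu>\<close> times that of the pullback
  of \<open>f h dz\<close>, and the change of coordinates preserves the latter.\<close>

lemma circle_functional_composition:
  assumes V: "open V" "convex V" "0 \<in> V" "V - {0} \<subseteq> U" and r: "r > 0" "cball 0 r \<subseteq> V"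
    and \<psi>: "\<psi> holomorphic_on V" "\<psi> ` V \<subseteq> V" "\<And>z. z \<in> V \<Longrightarrow> \<psi> z = 0 \<longleftrightarrow> z = 0" "deriv \<psi> 0 \<noteq> 0"
    and eq: "\<And>z. z \<in> V - {0} \<Longrightarrow> \<psi> z = \<phi> z"
    and h: "h holomorphic_on V" "\<mu> \<noteq> 0" "\<And>z. z \<in> V \<Longrightarrow> deriv \<psi> z * h (\<psi> z) = \<mu> * h z"
    and f: "f \<in> holomorphic_functions U"
  shows "circle_functional r h (composition_operator U \<phi> f) = (1 / \<mu>) * circle_functional r h f"
proof -
  have f_hol: "f holomorphic_on V - {0}"
    using f V holomorphic_on_subset by (auto simp: holomorphic_functions_def)
  have F: "(\<lambda>z. f z * h z) holomorphic_on V - {0}"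
    by (intro holomorphic_intros f_hol holomorphic_on_subset[OF h(1)]) auto
  have "circle_functional r h (composition_operator U \<phi> f)
      = contour_integral (circlepath 0 r) (\<lambda>z. (1 / \<mu>) * (deriv \<psi> z * (f (\<psi> z) * h (\<psi> z))))"
    unfolding circle_functional_def
  proof (rule contour_integral_eq)
    fix z :: complex assume "z \<in> path_image (circlepath 0 r)"
    then have z: "z \<in> V" "z \<noteq> 0" using r by auto
    have "(1 / \<mu>) * (deriv \<psi> z * (f (\<psi> z) * h (\<psi> z))) = (1 / \<mu>) * f (\<psi> z) * (deriv \<psi> z * h (\<psi> z))"
      by (simp add: mult_ac)
    also have "\<dots> = f (\<psi> z) * h z"
      using h(2) h(3)[OF z(1)] by simp
    also have "\<dots> = composition_operator U \<phi> f z * h z"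
      using z V eq by (auto simp: composition_operator_def)
    finally show "composition_operator U \<phi> f z * h z = (1 / \<mu>) * (deriv \<psi> z * (f (\<psi> z) * h (\<psi> z)))" ..
  qed
  also have "\<dots> = (1 / \<mu>) * contour_integral (circlepath 0 r) (\<lambda>z. deriv \<psi> z * (f (\<psi> z) * h (\<psi> z)))"
  proof (rule contour_integral_lmul, rule contour_integrable_continuous_circlepath)
    have "(\<lambda>z. deriv \<psi> z * ((\<lambda>w. f w * h w) \<circ> \<psi>) z) holomorphic_on V - {0}"
    proof (rule holomorphic_on_mult)
      show "deriv \<psi> holomorphic_on V - {0}"
        using holomorphic_deriv[OF \<psi>(1) V(1)] by (rule holomorphic_on_subset) auto
      have "\<psi> holomorphic_on V - {0}"
        using \<psi>(1) by (rule holomorphic_on_subset) auto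
      then have "(\<lambda>w. f w * h w) \<circ> \<psi> holomorphic_on V - {0}"
        by (rule holomorphic_on_compose_gen[OF _ F]) (use \<psi> in auto)
      then show "(\<lambda>z. ((\<lambda>w. f w * h w) \<circ> \<psi>) z) holomorphic_on V - {0}" .
    qed
    then have "continuous_on (V - {0}) (\<lambda>z. deriv \<psi> z * ((\<lambda>w. f w * h w) \<circ> \<psi>) z)"
      by (rule holomorphic_on_imp_continuous_on)
    then show "continuous_on (path_image (circlepath 0 r)) (\<lambda>z. deriv \<psi> z * (f (\<psi> z) * h (\<psi> z)))"
      unfolding o_def by (rule continuous_on_subset) (use r in auto)
  qed
  also have "contour_integral (circlepath 0 r) (\<lambda>z. deriv \<psi> z * (f (\<psi> z) * h (\<psi> z)))
      = circle_functional r h f"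
    unfolding circle_functional_def
    by (rule contour_integral_circlepath_substitution[OF V(1-3) r(1) _ \<psi> F]) (use r in auto)
  finally show ?thesis .
qed

lemma continuous_dual_add_cmult:
  assumes "L \<in> continuous_dual (compact_open_topology U)"
    and "f \<in> holomorphic_functions U" "g \<in> holomorphic_functions U"
  shows "L (\<lambda>z. f z + c * g z) = L f + c * L g"
  using assms holomorphic_functions_cmult[OF assms(3), of c]
  by (simp add: continuous_dual_def topspace_compact_open_topology)

text \<open>
  If \<open>\<sigma> z = z * \<tau> z\<close> satisfies \<open>\<sigma> \<circ> \<psi> = \<lambda> \<sigma>\<close>, then \<open>f \<mapsto> \<integral> f \<sigma>' dz\<close> and \<open>f \<mapsto> \<integral> f \<sigma> \<sigma>' dz\<close> are
  eigenfunctionals with eigenvalues \<open>1/\<lambda>\<close> and \<open>1/\<lambda>\<^sup>2\<close>.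
\<close>

lemma not_weakly_supercyclic_linearizable:
  assumes U: "open U" "0 \<notin> U" and hol: "\<phi> holomorphic_on U" "\<phi> ` U \<subseteq> U"
    and V: "open V" "convex V" "0 \<in> V" "V - {0} \<subseteq> U"
    and \<psi>: "\<psi> holomorphic_on V" "\<psi> ` V \<subseteq> V" "\<And>z. z \<in> V \<Longrightarrow> \<psi> z = 0 \<longleftrightarrow> z = 0" "deriv \<psi> 0 \<noteq> 0"
    and eq: "\<And>z. z \<in> V - {0} \<Longrightarrow> \<psi> z = \<phi> z"
    and \<tau>: "\<tau> holomorphic_on V" "\<tau> 0 \<noteq> 0" and "l \<noteq> 0"
    and lin: "\<And>z. z \<in> V \<Longrightarrow> \<psi> z * \<tau> (\<psi> z) = l * (z * \<tau> z)"
  shows "\<not> weakly_supercyclic (compact_open_topology U) (composition_operator U \<phi>)"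
proof -
  obtain r where r: "r > 0" "cball 0 r \<subseteq> V"
    using V open_contains_cball by blast
  have sphere: "sphere 0 r \<subseteq> U"
  proof
    fix z :: complex assume "z \<in> sphere 0 r"
    then have "z \<in> cball 0 r" "z \<noteq> 0" using r by auto
    then show "z \<in> U" using r V by blast
  qed
  define \<sigma> where "\<sigma> = (\<lambda>z. z * \<tau> z)"
  have \<sigma>: "\<sigma> holomorphic_on V" and d\<sigma>: "deriv \<sigma> holomorphic_on V"
    unfolding \<sigma>_def using \<tau> V by (intro holomorphic_intros; simp)+
  have "(\<sigma> has_field_derivative (0 * deriv \<tau> 0 + 1 * \<tau> 0)) (at 0)"
    unfolding \<sigma>_def using holomorphic_derivI[OF \<tau>(1) V(1,3)] by (intro derivative_eq_intros) auto
  then have d0: "deriv \<sigma> 0 \<noteq> 0"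
    using \<tau> by (simp add: DERIV_imp_deriv)
  \<comment> \<open>The derivative of \<open>\<sigma> \<circ> \<psi> = l * \<sigma>\<close>: the
    differential of \<open>\<sigma>\<close> is multiplied by \<open>l\<close> under
    pullback.\<close>
  have d\<psi>: "deriv \<psi> z * deriv \<sigma> (\<psi> z) = l * deriv \<sigma> z" if z: "z \<in> V" for z
  proof -
    have "\<psi> z \<in> V" using \<psi>(2) z by auto
    then have "((\<lambda>z. \<sigma> (\<psi> z)) has_field_derivative deriv \<sigma> (\<psi> z) * deriv \<psi> z) (at z)"
      using holomorphic_derivI[OF \<psi>(1) V(1) z] holomorphic_derivI[OF \<sigma> V(1)] by (intro DERIV_chain2)
    moreover have "((\<lambda>z. l * \<sigma> z) has_field_derivative l * deriv \<sigma> z) (at z)"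
      using holomorphic_derivI[OF \<sigma> V(1) z] by (intro derivative_eq_intros) auto
    then have "((\<lambda>z. \<sigma> (\<psi> z)) has_field_derivative l * deriv \<sigma> z) (at z)"
      by (rule has_field_derivative_transform_within_open[OF _ V(1) z]) (use lin in \<open>simp add: \<sigma>_def\<close>)
    ultimately show ?thesis
      using DERIV_unique by (metis mult.commute)
  qed
  define L where "L = circle_functional r (deriv \<sigma>)"
  define M where "M = circle_functional r (\<lambda>z. \<sigma> z * deriv \<sigma> z)"
  let ?X = "compact_open_topology U"
  have cont: "continuous_on (sphere 0 r) (deriv \<sigma>)" "continuous_on (sphere 0 r) \<sigma>"
    using r by (auto intro!: holomorphic_on_imp_continuous_on holomorphic_on_subset[OF \<sigma>] holomorphic_on_subset[OF d\<sigma>])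
  have L: "L \<in> continuous_dual ?X" and M: "M \<in> continuous_dual ?X"
    unfolding L_def M_def using cont sphere r
    by (auto intro!: circle_functional_continuous_dual continuous_intros)
  have LT: "L (composition_operator U \<phi> f) = (1 / l) * L f" if "f \<in> topspace ?X" for f
    unfolding L_def using that topspace_compact_open_topology d\<psi> \<open>l \<noteq> 0\<close>
    by (intro circle_functional_composition[OF V r \<psi> eq d\<sigma>]) auto
  have MT: "M (composition_operator U \<phi> f) = (1 / l\<^sup>2) * M f" if f: "f \<in> topspace ?X" for f
    unfolding M_def
  proof (rule circle_functional_composition[OF V r \<psi> eq])
    show "(\<lambda>z. \<sigma> z * deriv \<sigma> z) holomorphic_on V" using \<sigma> d\<sigma> by (rule holomorphic_on_mult)
    show "deriv \<psi> z * (\<sigma> (\<psi> z) * deriv \<sigma> (\<psi> z)) = l\<^sup>2 * (\<sigma> z * deriv \<sigma> z)" if "z \<in> V" for z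
    proof -
      have "\<sigma> (\<psi> z) = l * \<sigma> z" using lin[OF that] by (simp add: \<sigma>_def)
      then have "deriv \<psi> z * (\<sigma> (\<psi> z) * deriv \<sigma> (\<psi> z)) = l * \<sigma> z * (deriv \<psi> z * deriv \<sigma> (\<psi> z))"
        by (simp add: mult_ac)
      then show ?thesis by (simp add: d\<psi>[OF that] power2_eq_square mult_ac)
    qed
  qed (use f \<open>l \<noteq> 0\<close> in \<open>auto simp: topspace_compact_open_topology\<close>)
  \<comment> \<open>\<open>L\<close> detects the simple pole \<open>p\<close>. The kernel of
    \<open>M\<close> has a simple zero at \<open>0\<close>, so \<open>M\<close> kills
    \<open>p\<close> but detects \<open>q\<close>.\<close>
  define p q where "p = extend_zero U (\<lambda>z. 1 / z)" and "q = extend_zero U (\<lambda>z. 1 / z\<^sup>2)"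
  have pq: "p \<in> holomorphic_functions U" "q \<in> holomorphic_functions U"
    unfolding p_def q_def using U
    by (auto intro!: extend_zero_in_holomorphic_functions holomorphic_intros)
  note pq' = pq[folded topspace_compact_open_topology]
  have "L p = 2 * of_real pi * \<i> * deriv \<sigma> 0"
    unfolding L_def p_def by (rule circle_functional_simple_pole[OF d\<sigma> r(2) sphere r(1)]) simp
  then have Lp: "L p \<noteq> 0" using d0 by simp
  have "M p = 2 * of_real pi * \<i> * (\<sigma> 0 * deriv \<sigma> 0)"
    unfolding M_def p_def
    by (rule circle_functional_simple_pole[OF _ r(2) sphere r(1)]) (use \<sigma> d\<sigma> in \<open>auto intro: holomorphic_intros\<close>)
  then have Mp: "M p = 0" by (simp add: \<sigma>_def)
  have "M q = 2 * of_real pi * \<i> * (\<tau> 0 * deriv \<sigma> 0)"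
    unfolding M_def q_def
    by (rule circle_functional_simple_pole[OF _ r(2) sphere r(1)])
      (use \<tau> d\<sigma> in \<open>auto intro: holomorphic_intros simp: \<sigma>_def power2_eq_square\<close>)
  then have Mq: "M q \<noteq> 0" using d0 \<tau> by simp
  have endo: "\<And>f. f \<in> topspace ?X \<Longrightarrow> composition_operator U \<phi> f \<in> topspace ?X"
    using composition_operator_endo hol by blast
  \<comment> \<open>The criterion needs the functional with the smaller eigenvalue first, so the
    roles of \<open>L\<close> and \<open>M\<close> depend on \<open>norm l\<close>. A multiplier
    with \<open>norm l > 1\<close> occurs for linear maps of the punctured plane.\<close>
  show ?thesis
  proof (cases "norm l \<le> 1")
    case True
    have le: "norm (1 / l) \<le> norm (1 / l\<^sup>2)"
    proof -
      have "norm l * norm l \<le> norm l * 1" using True by (intro mult_left_mono) auto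
      then show ?thesis
        using \<open>l \<noteq> 0\<close> by (simp add: norm_divide norm_power power2_eq_square norm_mult frac_le)
    qed
    show ?thesis
      by (rule not_weakly_supercyclic_two_eigenfunctionals[where X = ?X and
            T = "composition_operator U \<phi>" and L = L and M = M and \<alpha> = "1 / l" and \<beta> = "1 / l\<^sup>2",
            OF endo L LT M MT le pq'(1) Lp Mp pq'(2) Mq])
  next
    case False
    \<comment> \<open>\<open>L q\<close> need not vanish; the multiple of \<open>p\<close> corrects
      this without changing the value of \<open>M\<close>.\<close>
    define c where "c = - L q / L p"
    define g where "g = (\<lambda>z. q z + c * p z)"
    have g: "g \<in> topspace ?X" "M g \<noteq> 0" "L g = 0"
      using pq continuous_dual_add_cmult[OF L pq(2,1), of c] continuous_dual_add_cmult[OF M pq(2,1), of c] Lp Mp Mq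
      by (auto simp: g_def c_def topspace_compact_open_topology holomorphic_functions_def intro!: holomorphic_intros)
    have le: "norm (1 / l\<^sup>2) \<le> norm (1 / l)"
    proof -
      have "norm l * 1 \<le> norm l * norm l" using False by (intro mult_left_mono) auto
      then show ?thesis
        using \<open>l \<noteq> 0\<close> by (simp add: norm_divide norm_power power2_eq_square norm_mult frac_le)
    qed
    show ?thesis
      by (rule not_weakly_supercyclic_two_eigenfunctionals[where X = ?X and
            T = "composition_operator U \<phi>" and L = M and M = L and \<alpha> = "1 / l\<^sup>2" and \<beta> = "1 / l",
            OF endo M MT L LT le g pq'(1) Lp])
  qed
qed

lemma not_weakly_supercyclic_punctured_disc:
  fixes \<phi> :: "complex \<Rightarrow> complex"
  defines "U \<equiv> ball 0 1 - {0}"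
  assumes hol: "\<phi> holomorphic_on U" "\<phi> ` U \<subseteq> U"
  shows "\<not> weakly_supercyclic (compact_open_topology U) (composition_operator U \<phi>)"
proof
  assume ws: "weakly_supercyclic (compact_open_topology U) (composition_operator U \<phi>)"
  have U: "open U" "0 \<notin> U" by (auto simp: U_def)
  have "infinite U"
    unfolding U_def using uncountable_ball[of 1 "0::complex"] uncountable_infinite by auto
  then have inj: "inj_on \<phi> U"
    using weakly_supercyclic_imp_inj_on[OF ws hol] by blast
  have \<phi>U: "norm (\<phi> z) < 1 \<and> \<phi> z \<noteq> 0" if "z \<in> U" for z
  proof -
    have "\<phi> z \<in> U" using hol(2) that by blast
    then show ?thesis by (simp add: U_def)
  qed
  have near: "\<forall>\<^sub>F z in at 0. z \<in> U"
    unfolding eventually_at U_def by (intro exI[of _ 1]) auto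
  have bounded: "\<forall>\<^sub>F z in at 0. norm (\<phi> z) \<le> 1"
    using near by eventually_elim (use \<phi>U in force)
  then obtain \<psi> where \<psi>: "\<psi> holomorphic_on ball 0 1" and eq: "\<And>z. z \<in> U \<Longrightarrow> \<psi> z = \<phi> z"
    using holomorphic_on_extend_bounded[of \<phi> "ball 0 1" 0] hol by (auto simp: U_def)
  have "\<psi> \<midarrow>0\<rightarrow> \<psi> 0"
    using \<psi> continuous_on_interior[of "ball 0 1" \<psi> 0] holomorphic_on_imp_continuous_on
    by (auto simp: isCont_def)
  moreover have "\<forall>\<^sub>F z in at 0. norm (\<psi> z) \<le> 1"
    using near by eventually_elim (use \<phi>U eq in force)
  ultimately have "norm (\<psi> 0) \<le> 1"
    by (rule Lim_norm_ubound[rotated]) simp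
  then have "\<psi> ` ball 0 1 \<subseteq> cball 0 1"
    using \<phi>U eq by (force simp: U_def less_imp_le)
  \<comment> \<open>The limit at \<open>0\<close> only gives \<open>norm (\<psi> 0) \<le> 1\<close>;
    an open image inside the closed disc lies in its interior.\<close>
  moreover have "open (\<psi> ` ball 0 1)"
  proof (rule open_mapping_thm[OF \<psi>])
    show "\<not> \<psi> constant_on ball 0 1"
    proof
      assume "\<psi> constant_on ball 0 1"
      then have "\<psi> (1/2) = \<psi> (1/3)" by (auto simp: constant_on_def)
      then have "\<phi> (1/2) = \<phi> (1/3)" by (simp add: eq U_def)
      then show False using inj_onD[OF inj, of "1/2" "1/3"] by (simp add: U_def)
    qed
  qed auto
  ultimately have "\<psi> ` ball 0 1 \<subseteq> ball 0 1"
    using interior_maximal[of "\<psi> ` ball 0 1" "cball 0 1"] by simp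
  then have \<psi>_ball: "norm (\<psi> z) < 1" if "norm z < 1" for z
    using that by (auto simp: image_subset_iff)
  show False
  proof (cases "\<psi> 0 = 0")
    case False
    then have "\<psi> 0 \<in> U" using \<psi>_ball[of 0] by (simp add: U_def)
    then show False
      using not_weakly_supercyclic_extends_into[OF U hol zero_less_one _ \<psi>] ws eq by (simp add: U_def)
  next
    case True
    have \<psi>0: "\<psi> z = 0 \<longleftrightarrow> z = 0" if "z \<in> ball 0 1" for z
      using that True \<phi>U[of z] eq[of z] by (cases "z = 0") (simp_all add: U_def)
    \<comment> \<open>Injectivity extends to \<open>0\<close> because \<open>\<psi>\<close> vanishes
      only there; it makes the multiplier nonzero.\<close>
    have "inj_on \<psi> (ball 0 1)"
    proof (rule inj_onI)
      fix x y :: complex assume xy: "x \<in> ball 0 1" "y \<in> ball 0 1" "\<psi> x = \<psi> y"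
      show "x = y"
      proof (cases "x = 0 \<or> y = 0")
        case True
        then show ?thesis using xy \<psi>0 by metis
      next
        case False
        then show ?thesis using xy eq inj_onD[OF inj, of x y] by (simp add: U_def)
      qed
    qed
    then have d0: "deriv \<psi> 0 \<noteq> 0"
      using \<psi> by (intro holomorphic_injective_imp_regular[of _ "ball 0 1"]) auto
    have "norm (deriv \<psi> 0) \<le> 1"
      using Schwarz_Lemma(2)[OF \<psi> True \<psi>_ball, of 0] by simp
    then consider "norm (deriv \<psi> 0) < 1" | "norm (deriv \<psi> 0) = 1" by linarith
    then show False
    proof cases
      case 1
      obtain r \<tau> where r: "r > 0" "ball 0 r \<subseteq> ball (0::complex) 1" "\<psi> ` ball 0 r \<subseteq> ball 0 r"
        and \<tau>: "\<tau> holomorphic_on ball 0 r" "\<tau> 0 \<noteq> 0"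
          "\<And>z. z \<in> ball 0 r \<Longrightarrow> \<psi> z * \<tau> (\<psi> z) = deriv \<psi> 0 * (z * \<tau> z)"
        by (rule Koenigs_linearization[OF open_ball _ \<psi> True d0 1]) auto
      have "\<not> weakly_supercyclic (compact_open_topology U) (composition_operator U \<phi>)"
      proof (rule not_weakly_supercyclic_linearizable[OF U hol open_ball convex_ball _ _ _ r(3) _ d0 _ \<tau>(1,2) d0 \<tau>(3)])
        show "\<psi> holomorphic_on ball 0 r" using \<psi> r(2) holomorphic_on_subset by blast
        show "ball 0 r - {0} \<subseteq> U" using r(2) by (auto simp: U_def)
        show "\<psi> z = 0 \<longleftrightarrow> z = 0" if "z \<in> ball 0 r" for z using \<psi>0 r(2) that by blast
        show "\<psi> z = \<phi> z" if "z \<in> ball 0 r - {0}" for z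
          using eq[of z] r(2) that unfolding U_def by blast
      qed (use r in auto)
      then show False using ws by blast
    next
      case 2
      then obtain \<alpha> where \<alpha>: "\<And>z. norm z < 1 \<Longrightarrow> \<psi> z = \<alpha> * z" "norm \<alpha> = 1"
        using Schwarz_Lemma(3)[OF \<psi> True \<psi>_ball, of 0] by auto
      \<comment> \<open>A rotation is its own linearization: \<open>V\<close> is the whole disc and
        \<open>\<tau>\<close> is the constant \<open>1\<close>.\<close>
      have "\<not> weakly_supercyclic (compact_open_topology U) (composition_operator U \<phi>)"
      proof (rule not_weakly_supercyclic_linearizable[OF U hol open_ball convex_ball _ _ \<psi> \<open>\<psi> ` ball 0 1 \<subseteq> ball 0 1\<close> \<psi>0 d0])
        show "\<psi> z * 1 = \<alpha> * (z * 1)" if "z \<in> ball 0 1" for z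
          using \<alpha>(1)[of z] that by simp
        show "\<alpha> \<noteq> 0" using \<alpha>(2) by auto
      qed (use eq in \<open>auto simp: U_def\<close>)
      then show False using ws by blast
    qed
  qed
qed

theorem theoremD:
  fixes U :: "complex set" and \<phi> :: "complex \<Rightarrow> complex"
  assumes "U = ball 0 1 - {0} \<or> U = UNIV - {0}"
    and "\<phi> holomorphic_on U"
    and "\<phi> ` U \<subseteq> U"
  shows "\<not> weakly_supercyclic (compact_open_topology U) (composition_operator U \<phi>)"
proof (cases "U = ball 0 1 - {0}")
  case True
  then show ?thesis using assms not_weakly_supercyclic_punctured_disc by blast
next
  case False
  with assms have U_def: "U = UNIV - {0}" and hol: "\<phi> holomorphic_on U" "\<phi> ` U \<subseteq> U" by auto
  show ?thesis
  proof
    assume ws: "weakly_supercyclic (compact_open_topology U) (composition_operator U \<phi>)"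
    have U: "open U" "0 \<notin> U" by (auto simp: U_def)
    have "infinite U"
      unfolding U_def using infinite_UNIV_char_0[where 'a = complex] by simp
    then have inj: "inj_on \<phi> (UNIV - {0})"
      using weakly_supercyclic_imp_inj_on[OF ws hol] by (simp add: U_def)
    have nz: "\<phi> z \<noteq> 0" if "z \<noteq> 0" for z
      using hol(2) that by (auto simp: U_def)
    \<comment> \<open>Serves the extensions of both \<open>\<phi>\<close> and
      \<open>1 / \<phi>\<close>; the last assumption transfers injectivity from
      \<open>\<phi>\<close> to either.\<close>
    have linear: "\<exists>a. a \<noteq> 0 \<and> (\<forall>z. \<psi> z = a * z)"
      if \<psi>: "\<psi> holomorphic_on UNIV" "\<psi> 0 = 0" and \<psi>0: "\<And>z. z \<noteq> 0 \<Longrightarrow> \<psi> z \<noteq> 0"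
        and \<psi>\<phi>: "\<And>x y. \<lbrakk>x \<noteq> 0; y \<noteq> 0; \<psi> x = \<psi> y\<rbrakk> \<Longrightarrow> \<phi> x = \<phi> y" for \<psi>
    proof -
      have "inj \<psi>"
      proof (rule injI)
        fix x y assume xy: "\<psi> x = \<psi> y"
        show "x = y"
        proof (cases "x = 0 \<or> y = 0")
          case True
          then show ?thesis using xy \<psi>0 \<psi>(2) by metis
        next
          case False
          then show ?thesis using \<psi>\<phi>[of x y] xy inj_onD[OF inj, of x y] by simp
        qed
      qed
      then show ?thesis
        using injective_entire_linear[OF \<psi>(1) _ \<psi>(2)] by metis
    qed
    have "\<phi> holomorphic_on UNIV - {0}" using hol by (simp add: U_def)
    then show False
    proof (rule injective_punctured_plane_extends[OF _ inj nz])
      fix \<psi> assume \<psi>: "\<psi> holomorphic_on UNIV" and eq: "\<And>z. z \<noteq> 0 \<Longrightarrow> \<psi> z = \<phi> z"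
      show False
      proof (cases "\<psi> 0 = 0")
        case False
        \<comment> \<open>A nonzero value at \<open>0\<close> lies in \<open>U\<close>, so
          composition removes singularities at \<open>0\<close>.\<close>
        have "\<psi> holomorphic_on ball 0 1" using \<psi> holomorphic_on_subset by blast
        then show False
          using not_weakly_supercyclic_extends_into[OF U hol zero_less_one _ _ _ , of \<psi>] ws eq False
          by (simp add: U_def subset_iff)
      next
        case True
        have "\<exists>a. a \<noteq> 0 \<and> (\<forall>z. \<psi> z = a * z)"
          by (rule linear[OF \<psi> True]) (use eq nz in auto)
        then obtain a where a: "a \<noteq> 0" "\<psi> = (\<lambda>z. a * z)" by auto
        have "\<not> weakly_supercyclic (compact_open_topology U) (composition_operator U \<phi>)"
          by (rule not_weakly_supercyclic_linearizable[OF U hol, of UNIV \<psi> "\<lambda>z. 1" a])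
            (use \<psi> eq a in \<open>auto simp: U_def\<close>)
        then show False using ws by blast
      qed
    next
      fix \<psi> assume \<psi>: "\<psi> holomorphic_on UNIV" "\<psi> 0 = 0" and eq: "\<And>z. z \<noteq> 0 \<Longrightarrow> \<psi> z = 1 / \<phi> z"
      have "\<exists>a. a \<noteq> 0 \<and> (\<forall>z. \<psi> z = a * z)"
        by (rule linear[OF \<psi>]) (use eq nz in auto)
      then obtain a where a: "a \<noteq> 0" "\<And>z. \<psi> z = a * z" by auto
      have \<phi>: "\<phi> z = 1 / (a * z)" if "z \<noteq> 0" for z
        using eq[OF that] a nz[OF that] that by (simp add: field_simps)
      \<comment> \<open>The fixed points of \<open>z \<mapsto> 1 / (a * z)\<close> are the two
        square roots of \<open>1 / a\<close>.\<close>
      define s where "s = csqrt (1 / a)"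
      have s: "s * s = 1 / a" unfolding s_def by (metis power2_csqrt power2_eq_square)
      then have "s \<noteq> 0" using a by auto
      moreover have "1 / (a * s) = s" using s a \<open>s \<noteq> 0\<close> by (simp add: field_simps)
      ultimately have "\<not> weakly_supercyclic (compact_open_topology U) (composition_operator U \<phi>)"
        by (intro not_weakly_supercyclic_two_fixed_points[OF hol, of s "- s"]) (auto simp: U_def \<phi>)
      then show False using ws by blast
    qed
  qed
qed

end
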